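(* Let $k,k'\geq 1$ and $\ell\geq 3$ be integers. Let $(W,S)$ be the Coxeter system of rank $4$ with $S=\{s_1,s_2,s_3,s_4\}$ and Coxeter matrix entries $m_{s_1s_2}=2k+1$, $m_{s_2s_3}=\ell$, $m_{s_3s_4}=2k'+1$, $m_{s_4s_1}=\ell$, $m_{s_1s_3}=m_{s_2s_4}=2$. Let $c=s_3s_1s_2s_4$. Then $[1,c]_T$ is not a lattice.
   Context: $T=\bigcup_{w\in W} wSw^{-1}$ is the set of reflections of $W$. The reflection length $\ell_T(w)$ is the smallest $j\ge 0$ such that $w$ is a product of $j$ elements of $T$. The absolute order is the partial order on $W$ defined by $u\leq_T v \iff \ell_T(u)+\ell_T(u^{-1}v)=\ell_T(v)$. $[1,c]_T=\{x\in W\mid x\leq_T c\}$, ordered by $\leq_T$. *)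

theory Defs
  imports "HOL-Algebra.Lattice" "HOL-Algebra.Generated_Groups"
begin

text \<open>
  Coxeter matrices over a set \<open>S\<close>. The value \<open>0\<close> stands for the entry \<open>\<infinity>\<close>: it makes the
  relator \<open>(s t)\<^sup>m\<close> below the empty word, so that no relation is imposed.
\<close>

definition coxeter_matrix :: "'a set \<Rightarrow> ('a \<Rightarrow> 'a \<Rightarrow> nat) \<Rightarrow> bool" where
  "coxeter_matrix S m \<longleftrightarrow>
     (\<forall>s\<in>S. \<forall>t\<in>S. m s t = m t s \<and> (m s t = 1 \<longleftrightarrow> s = t))"

definition relator :: "('a \<Rightarrow> 'a \<Rightarrow> nat) \<Rightarrow> 'a \<Rightarrow> 'a \<Rightarrow> 'a list" where
  "relator m s t = concat (replicate (m s t) [s, t])"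

text \<open>
  The congruence on words over \<open>S\<close> generated by \<open>(s t)\<^sup>m = 1\<close>. The relators for \<open>s = t\<close> are
  \<open>s s\<close>, so every generator is its own inverse and words without formal inverses suffice:
  the quotient monoid is the group \<open>\<langle>S | (s t)\<^sup>m = 1\<rangle>\<close>.
\<close>

inductive word_eq :: "'a set \<Rightarrow> ('a \<Rightarrow> 'a \<Rightarrow> nat) \<Rightarrow> 'a list \<Rightarrow> 'a list \<Rightarrow> bool"
  for S :: "'a set" and m :: "'a \<Rightarrow> 'a \<Rightarrow> nat" where
  word_eq_refl: "u \<in> lists S \<Longrightarrow> word_eq S m u u"
| word_eq_sym: "word_eq S m u v \<Longrightarrow> word_eq S m v u"
| word_eq_trans: "word_eq S m u v \<Longrightarrow> word_eq S m v w \<Longrightarrow> word_eq S m u w"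
| word_eq_relator: "u \<in> lists S \<Longrightarrow> v \<in> lists S \<Longrightarrow> s \<in> S \<Longrightarrow> t \<in> S \<Longrightarrow>
    word_eq S m (u @ relator m s t @ v) (u @ v)"

definition word_prod :: "('a, 'b) monoid_scheme \<Rightarrow> 'a list \<Rightarrow> 'a" where
  "word_prod G xs = foldr (\<lambda>x y. x \<otimes>\<^bsub>G\<^esub> y) xs \<one>\<^bsub>G\<^esub>"

text \<open>
  \<open>(W, S)\<close> is a Coxeter system with matrix \<open>m\<close>: \<open>W\<close> is a group generated by \<open>S\<close>, with the
  presentation \<open>\<langle>S | (s t)\<^sup>m = 1\<rangle>\<close>.
\<close>

definition coxeter_system ::
    "('a, 'b) monoid_scheme \<Rightarrow> 'a set \<Rightarrow> ('a \<Rightarrow> 'a \<Rightarrow> nat) \<Rightarrow> bool" where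
  "coxeter_system W S m \<longleftrightarrow>
     group W \<and> S \<subseteq> carrier W \<and> generate W S = carrier W \<and> coxeter_matrix S m \<and>
     (\<forall>u\<in>lists S. \<forall>v\<in>lists S. word_prod W u = word_prod W v \<longleftrightarrow> word_eq S m u v)"

definition reflections :: "('a, 'b) monoid_scheme \<Rightarrow> 'a set \<Rightarrow> 'a set" where
  "reflections W S = (\<Union>w\<in>carrier W. (\<lambda>s. w \<otimes>\<^bsub>W\<^esub> s \<otimes>\<^bsub>W\<^esub> inv\<^bsub>W\<^esub> w) ` S)"

definition reflection_length :: "('a, 'b) monoid_scheme \<Rightarrow> 'a set \<Rightarrow> 'a \<Rightarrow> nat" where
  "reflection_length W S w =
     (LEAST j. \<exists>ts\<in>lists (reflections W S). length ts = j \<and> word_prod W ts = w)"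

definition absolute_le :: "('a, 'b) monoid_scheme \<Rightarrow> 'a set \<Rightarrow> 'a \<Rightarrow> 'a \<Rightarrow> bool" where
  "absolute_le W S u v \<longleftrightarrow>
     reflection_length W S u + reflection_length W S (inv\<^bsub>W\<^esub> u \<otimes>\<^bsub>W\<^esub> v) = reflection_length W S v"

definition absolute_interval :: "('a, 'b) monoid_scheme \<Rightarrow> 'a set \<Rightarrow> 'a \<Rightarrow> 'a gorder" where
  "absolute_interval W S c =
     \<lparr>carrier = {x \<in> carrier W. absolute_le W S x c}, eq = (=), le = absolute_le W S\<rparr>"

text \<open>
  The HOL-Algebra predicate \<open>lattice\<close> includes being a partial order. For a Coxeter system the
  interval always is one (shown below), so \<open>\<not> lattice\<close> says that some join or meet is missing.
\<close>

context
  fixes W :: "('a, 'b) monoid_scheme" and S :: "'a set" and m :: "'a \<Rightarrow> 'a \<Rightarrow> nat"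
  assumes cs: "coxeter_system W S m"
begin

interpretation group W
  using cs by (simp add: coxeter_system_def)

lemma S_carrier: "S \<subseteq> carrier W"
  using cs by (simp add: coxeter_system_def)

lemma word_prod_closed: "xs \<in> lists (carrier W) \<Longrightarrow> word_prod W xs \<in> carrier W"
  by (induction xs) (auto simp: word_prod_def)

lemma word_prod_append:
  "xs \<in> lists (carrier W) \<Longrightarrow> ys \<in> lists (carrier W) \<Longrightarrow>
     word_prod W (xs @ ys) = word_prod W xs \<otimes>\<^bsub>W\<^esub> word_prod W ys"
proof (induction xs)
  case Nil
  then show ?case using word_prod_closed[of ys] by (simp add: word_prod_def)
next
  case (Cons a xs)
  then show ?case
    using word_prod_closed[of ys] word_prod_closed[of xs] by (simp add: word_prod_def m_assoc)
qed

lemma generator_square: "s \<in> S \<Longrightarrow> s \<otimes>\<^bsub>W\<^esub> s = \<one>\<^bsub>W\<^esub>"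
proof -
  assume s: "s \<in> S"
  have "m s s = 1" using cs s by (simp add: coxeter_system_def coxeter_matrix_def)
  then have "word_eq S m [s, s] []"
    using word_eq_relator[of "[]" S "[]" s s m] s by (simp add: relator_def)
  then have "word_prod W [s, s] = word_prod W []"
    using cs s unfolding coxeter_system_def by (metis Cons_in_lists_iff lists.Nil)
  then show ?thesis using s S_carrier by (auto simp: word_prod_def)
qed

lemma reflections_carrier: "reflections W S \<subseteq> carrier W"
  using S_carrier by (auto simp: reflections_def)

lemma generators_reflections: "S \<subseteq> reflections W S"
proof
  fix s assume s: "s \<in> S"
  then have "s = \<one>\<^bsub>W\<^esub> \<otimes>\<^bsub>W\<^esub> s \<otimes>\<^bsub>W\<^esub> inv\<^bsub>W\<^esub> \<one>\<^bsub>W\<^esub>" using S_carrier by auto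
  with s show "s \<in> reflections W S" unfolding reflections_def using one_closed by blast
qed

lemma generators_word:
  assumes "w \<in> carrier W"
  shows "\<exists>ts\<in>lists S. word_prod W ts = w"
proof -
  have "w \<in> generate W S" using cs assms by (simp add: coxeter_system_def)
  then show ?thesis
  proof induction
    case one
    show ?case by (rule bexI[of _ "[]"]) (auto simp: word_prod_def)
  next
    case (incl h)
    then show ?case using S_carrier by (intro bexI[of _ "[h]"]) (auto simp: word_prod_def)
  next
    case (inv h)
    then have "inv\<^bsub>W\<^esub> h = h" using generator_square S_carrier inv_equality by blast
    then show ?case using inv S_carrier by (intro bexI[of _ "[h]"]) (auto simp: word_prod_def)
  next
    case (eng h1 h2)
    then obtain us vs where u: "us \<in> lists S" "word_prod W us = h1"
      and v: "vs \<in> lists S" "word_prod W vs = h2" by blast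
    have "word_prod W (us @ vs) = h1 \<otimes>\<^bsub>W\<^esub> h2"
      using u v S_carrier word_prod_append[of us vs] by (metis in_mono lists_mono)
    then show ?case using u v by (intro bexI[of _ "us @ vs"]) auto
  qed
qed

lemma reflection_length_witness:
  assumes "w \<in> carrier W"
  shows "\<exists>ts\<in>lists (reflections W S). length ts = reflection_length W S w \<and> word_prod W ts = w"
proof -
  have "\<exists>j. \<exists>ts\<in>lists (reflections W S). length ts = j \<and> word_prod W ts = w"
    using generators_word[OF assms] generators_reflections by (meson in_mono lists_mono)
  then show ?thesis unfolding reflection_length_def by (rule LeastI_ex)
qed

lemma reflection_length_le:
  "ts \<in> lists (reflections W S) \<Longrightarrow> reflection_length W S (word_prod W ts) \<le> length ts"
  unfolding reflection_length_def by (rule Least_le) blast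

lemma reflection_length_one: "reflection_length W S \<one>\<^bsub>W\<^esub> = 0"
  using reflection_length_le[of "[]"] by (simp add: word_prod_def)

lemma reflection_length_eq_0:
  "w \<in> carrier W \<Longrightarrow> reflection_length W S w = 0 \<Longrightarrow> w = \<one>\<^bsub>W\<^esub>"
  using reflection_length_witness[of w] by (auto simp: word_prod_def)

lemma reflection_length_mult:
  assumes "x \<in> carrier W" "y \<in> carrier W"
  shows "reflection_length W S (x \<otimes>\<^bsub>W\<^esub> y) \<le> reflection_length W S x + reflection_length W S y"
proof -
  obtain us where u: "us \<in> lists (reflections W S)" "length us = reflection_length W S x"
    "word_prod W us = x" using reflection_length_witness[OF assms(1)] by blast
  obtain vs where v: "vs \<in> lists (reflections W S)" "length vs = reflection_length W S y"
    "word_prod W vs = y" using reflection_length_witness[OF assms(2)] by blast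
  have "word_prod W (us @ vs) = x \<otimes>\<^bsub>W\<^esub> y"
    using u v reflections_carrier word_prod_append[of us vs] by (metis in_mono lists_mono)
  then show ?thesis using reflection_length_le[of "us @ vs"] u v by auto
qed

lemma absolute_le_trans:
  assumes "u \<in> carrier W" "v \<in> carrier W" "w \<in> carrier W"
    and "absolute_le W S u v" "absolute_le W S v w"
  shows "absolute_le W S u w"
proof -
  have 1: "(inv\<^bsub>W\<^esub> u \<otimes>\<^bsub>W\<^esub> v) \<otimes>\<^bsub>W\<^esub> (inv\<^bsub>W\<^esub> v \<otimes>\<^bsub>W\<^esub> w) = inv\<^bsub>W\<^esub> u \<otimes>\<^bsub>W\<^esub> w"
    using assms(1-3) by (metis inv_closed m_assoc m_closed r_inv l_one)
  have 2: "u \<otimes>\<^bsub>W\<^esub> (inv\<^bsub>W\<^esub> u \<otimes>\<^bsub>W\<^esub> w) = w"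
    using assms(1-3) by (simp add: m_assoc[symmetric])
  show ?thesis
    using assms reflection_length_mult[of "inv\<^bsub>W\<^esub> u \<otimes>\<^bsub>W\<^esub> v" "inv\<^bsub>W\<^esub> v \<otimes>\<^bsub>W\<^esub> w"]
      reflection_length_mult[of u "inv\<^bsub>W\<^esub> u \<otimes>\<^bsub>W\<^esub> w"] 1 2
    by (simp add: absolute_le_def)
qed

lemma absolute_le_antisym:
  assumes "u \<in> carrier W" "v \<in> carrier W" "absolute_le W S u v" "absolute_le W S v u"
  shows "u = v"
proof -
  have "reflection_length W S (inv\<^bsub>W\<^esub> u \<otimes>\<^bsub>W\<^esub> v) = 0"
    using assms(3,4) by (simp add: absolute_le_def)
  then have "inv\<^bsub>W\<^esub> u \<otimes>\<^bsub>W\<^esub> v = \<one>\<^bsub>W\<^esub>" using assms by (simp add: reflection_length_eq_0)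
  then show ?thesis using assms by (metis inv_closed inv_inv inv_equality)
qed

lemma partial_order_absolute_interval: "partial_order (absolute_interval W S c)"
proof
  show "\<And>x y z. \<lbrakk>x \<sqsubseteq>\<^bsub>absolute_interval W S c\<^esub> y; y \<sqsubseteq>\<^bsub>absolute_interval W S c\<^esub> z;
      x \<in> carrier (absolute_interval W S c); y \<in> carrier (absolute_interval W S c);
      z \<in> carrier (absolute_interval W S c)\<rbrakk> \<Longrightarrow> x \<sqsubseteq>\<^bsub>absolute_interval W S c\<^esub> z"
    by (auto simp: absolute_interval_def intro: absolute_le_trans)
qed (auto simp: absolute_interval_def absolute_le_def[of W S x x for x] reflection_length_one
      intro: absolute_le_antisym)

end

end

theory Submission
  imports "HOL-Analysis.Analysis" Defs
begin

text \<open>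
  A lattice would contain a join of any two reflections below \<open>c\<close>. The reflections to look at are
  \<open>x\<close>, which swaps \<open>s1\<close> and \<open>s2\<close> under conjugation, and \<open>y\<close>, which swaps \<open>s3\<close> and \<open>s4\<close>; they
  exist because both labels are odd, and their roots are proportional to \<open>\<alpha>1 + \<alpha>2\<close> and
  \<open>\<alpha>3 + \<alpha>4\<close> (\<open>odd_dihedral_reflection\<close>). Sliding \<open>x\<close> and \<open>y\<close> through the word
  \<open>s3 s1 s2 s4 = s1 s3 s4 s2\<close> shows that both of them lie below \<open>w = s3 x s4\<close> and below
  \<open>w' = s1 y s2\<close>, which are distinct elements of length 3 below \<open>c\<close>.

  A join \<open>j\<close> of \<open>x\<close> and \<open>y\<close> would thus have length 2: length 1 would force \<open>x = j = y\<close>, and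
  length 3 would force \<open>w = j = w'\<close>. If the length is 2, then \<open>j = x r = y r'\<close> and \<open>w = j t\<close> with
  reflections \<open>r\<close>, \<open>r'\<close>, \<open>t\<close>. The roots of the factors of such a product span a plane that depends
  on the product only (\<open>refl_pair_root_in_span\<close>). So the root of \<open>r\<close> lies in the plane
  spanned by \<open>\<alpha>1 + \<alpha>2\<close> and \<open>\<alpha>3 + \<alpha>4\<close>, because of \<open>x r = y r'\<close>, and in the plane spanned by
  \<open>x \<alpha>3\<close> and \<open>\<alpha>4\<close>, because of \<open>r t = (x s3 x) s4\<close>. These planes meet in a line whose vectors
  \<open>v\<close> have \<open>B v v \<le> 0\<close>, since \<open>\<ell> \<ge> 3\<close> makes the off-diagonal products large enough, whereas a
  root is a unit vector (\<open>no_bound_of_length_2\<close>).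

  Lengths are bounded below by linear algebra: the displacements \<open>w v - v\<close> of a product of \<open>n\<close>
  reflections span a space of dimension at most \<open>n\<close>. On the usual geometric representation
  this bound can fail to be sharp, because the canonical form may be degenerate (it is for the
  affine group with \<open>k = k' = 1\<close> and \<open>\<ell> = 3\<close>). Therefore \<open>W\<close> acts here on a space twice as large,
  where the form is nondegenerate and the simple roots have a dual family
  (\<open>coxeter_representation_exists\<close>).
\<close>

section \<open>Reflections of a symmetric bilinear form\<close>

locale symmetric_form =
  fixes B :: "'v::real_vector \<Rightarrow> 'v \<Rightarrow> real"
  assumes B_sym: "B u v = B v u"
    and B_add: "B (u + v) w = B u w + B v w"
    and B_scale: "B (a *\<^sub>R u) w = a * B u w"
    and B_nondegenerate: "(\<And>v. B v u = 0) \<Longrightarrow> u = 0"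
begin

lemma B_add_right: "B w (u + v) = B w u + B w v"
  by (simp only: B_sym[of w] B_add)

lemma B_scale_right: "B w (a *\<^sub>R u) = a * B w u"
  by (simp only: B_sym[of w] B_scale)

lemma B_diff: "B (u - v) w = B u w - B v w"
  using B_add[of "u - v" v w] by simp

lemma B_diff_right: "B w (u - v) = B w u - B w v"
  by (simp only: B_sym[of w] B_diff)

lemma B_zero: "B 0 w = 0"
  using B_add[of 0 0 w] by simp

lemmas B_linear = B_add B_add_right B_scale B_scale_right B_diff B_diff_right

text \<open>
  Dividing by \<open>B a a\<close> makes the reflection depend on the line of \<open>a\<close> only, so that a root such as
  \<open>\<alpha> s + \<alpha> t\<close> need not be normalised.
\<close>

definition refl :: "'v \<Rightarrow> 'v \<Rightarrow> 'v" where
  "refl a v = v - (2 * B v a / B a a) *\<^sub>R a"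

lemma refl_unit: "B a a = 1 \<Longrightarrow> refl a v = v - (2 * B v a) *\<^sub>R a"
  by (simp add: refl_def)

lemma B_refl: "B (refl a u) (refl a v) = B u v"
proof (cases "B a a = 0")
  case False
  define k where "k = 2 / B a a"
  have eq: "refl a w = w - (k * B w a) *\<^sub>R a" for w by (simp add: refl_def k_def)
  have "B (refl a u) (refl a v) = B u v + (k * B u a * B v a) * (k * B a a - 2)"
    unfolding eq by (simp add: B_linear B_sym[of a v] algebra_simps)
  also have "k * B a a = 2" using False by (simp add: k_def)
  finally show ?thesis by simp
qed (simp add: refl_def)

lemma refl_refl: "refl a (refl a v) = v"
  by (cases "B a a = 0") (simp_all add: refl_def B_linear)

lemma refl_conjugate: "refl a (refl b v) = refl (refl a b) (refl a v)"
proof -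
  have "refl a (v - r *\<^sub>R b) = refl a v - r *\<^sub>R refl a b" for r
    by (simp add: refl_def B_linear algebra_simps diff_divide_distrib)
  then show ?thesis by (simp add: refl_def[of b] refl_def[of "refl a b"] B_refl)
qed

lemma B_foldr_refl: "B (foldr refl bs u) (foldr refl bs v) = B u v"
  by (induction bs) (simp_all add: B_refl)

lemma foldr_refl_conjugate:
  "foldr refl bs (refl b v) = refl (foldr refl bs b) (foldr refl bs v)"
  by (induction bs) (simp_all, rule refl_conjugate)

lemma foldr_refl_displacement: "foldr refl bs v - v \<in> span (set bs)"
proof (induction bs)
  case Nil
  then show ?case by (simp add: span_zero)
next
  case (Cons a bs)
  let ?u = "foldr refl bs v"
  have "?u - v \<in> span (set (a # bs))"
    using Cons span_mono[of "set bs" "set (a # bs)"] by auto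
  moreover have "(2 * B ?u a / B a a) *\<^sub>R a \<in> span (set (a # bs))"
    by (simp add: span_base span_scale)
  ultimately have "(?u - v) - (2 * B ?u a / B a a) *\<^sub>R a \<in> span (set (a # bs))"
    by (rule span_diff)
  then show ?case by (simp add: refl_def[of a] algebra_simps)
qed

text \<open>
  The linear algebra behind lower bounds for reflection length: every displacement of a product of
  reflections is a combination of their roots.
\<close>

lemma card_le_reflections:
  assumes "independent A" "A \<subseteq> span (range (\<lambda>v. f v - v))" "\<And>v. f v = foldr refl bs v"
  shows "card A \<le> length bs"
proof -
  have "range (\<lambda>v. f v - v) \<subseteq> span (set bs)"
    using foldr_refl_displacement assms(3) by auto
  then have "A \<subseteq> span (set bs)" using assms(2) span_minimal subspace_span by blast
  then have "card A \<le> card (set bs)" using assms(1) independent_span_bound[of "set bs" A] by blast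
  also have "\<dots> \<le> length bs" by (rule card_length)
  finally show ?thesis .
qed

lemma dual_basis_inj:
  assumes "\<And>s t. s \<in> T \<Longrightarrow> t \<in> T \<Longrightarrow> B (\<delta> s) (\<alpha> t) = (if s = t then 1 else 0)"
  shows "inj_on \<alpha> T"
  using assms by (metis inj_onI zero_neq_one)

lemma dual_basis_independent:
  assumes dual: "\<And>s t. s \<in> T \<Longrightarrow> t \<in> T \<Longrightarrow> B (\<delta> s) (\<alpha> t) = (if s = t then 1 else 0)"
  shows "independent (\<alpha> ` T)"
proof
  assume "dependent (\<alpha> ` T)"
  then obtain s where s: "s \<in> T" "\<alpha> s \<in> span (\<alpha> ` T - {\<alpha> s})"
    unfolding dependent_def by blast
  have "span (\<alpha> ` T - {\<alpha> s}) \<subseteq> {v. B (\<delta> s) v = 0}"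
  proof (rule span_minimal)
    show "\<alpha> ` T - {\<alpha> s} \<subseteq> {v. B (\<delta> s) v = 0}" using dual s(1) by auto
    show "subspace {v. B (\<delta> s) v = 0}"
      using B_zero B_sym[of "\<delta> s" 0] by (auto simp: subspace_def B_linear)
  qed
  then show False using s dual[of s s] by auto
qed

lemma in_span_pair_obtain:
  fixes a b v :: "'v"
  assumes "v \<in> span {a, b}"
  obtains p q where "v = p *\<^sub>R a + q *\<^sub>R b"
proof -
  obtain p where "v - p *\<^sub>R a \<in> span {b}" using assms span_insert[of a "{b}"] by blast
  then obtain q where "v - p *\<^sub>R a = q *\<^sub>R b" using span_singleton[of b] by blast
  then show thesis using that[of p q] by (simp add: algebra_simps)
qed

text \<open>
  By nondegeneracy some \<open>v\<close> is orthogonal to \<open>q\<close> but not to \<open>p\<close>, unless the two reflections are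
  equal and cancel. The displacement of such a \<open>v\<close> is a nonzero multiple of \<open>p\<close>, and it is also a
  combination of \<open>u\<close> and \<open>w\<close>.
\<close>

lemma refl_pair_root_in_span:
  assumes p: "B p p \<noteq> 0" and q: "B q q \<noteq> 0"
    and eq: "\<And>v. refl p (refl q v) = refl u (refl w v)"
    and nontrivial: "\<exists>v. refl p (refl q v) \<noteq> v"
  shows "p \<in> span {u, w}"
proof -
  have "\<exists>v. B v q = 0 \<and> B v p \<noteq> 0"
  proof (rule ccontr)
    assume "\<not> ?thesis"
    then have perp: "B v q = 0 \<Longrightarrow> B v p = 0" for v by blast
    define e where "e = B q p / B q q"
    (* Every v becomes orthogonal to q once its component along q is removed. *)
    have "B v (p - e *\<^sub>R q) = 0" for v
      using perp[of "v - (B v q / B q q) *\<^sub>R q"] q by (simp add: B_linear e_def mult.commute)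
    then have pe: "p = e *\<^sub>R q" using B_nondegenerate[of "p - e *\<^sub>R q"] by simp
    then have "e \<noteq> 0" using p B_zero by auto
    then have "refl p v = refl q v" for v
      using q unfolding pe by (simp add: refl_def B_linear)
    then show False using nontrivial refl_refl by simp
  qed
  then obtain v where v: "B v q = 0" "B v p \<noteq> 0" by blast
  define r where "r = - (2 * B v p / B p p)"
  have "foldr refl [u, w] v - v \<in> span (set [u, w])" by (rule foldr_refl_displacement)
  moreover have "refl p (refl q v) - v = r *\<^sub>R p"
    using v(1) by (simp add: r_def refl_def)
  ultimately have "r *\<^sub>R p \<in> span {u, w}" by (simp add: eq)
  then have "inverse r *\<^sub>R (r *\<^sub>R p) \<in> span {u, w}" by (rule span_scale)
  then show ?thesis using v p by (simp add: r_def)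
qed

text \<open>
  The product of the two reflections rotates their plane by \<open>2\<theta>\<close>. The closed form for its powers
  serves twice: for \<open>\<theta> = \<pi>/n\<close> the \<open>n\<close>-th power is the identity, which is the Coxeter relation, and
  for \<open>\<theta> = \<pi>/(2k+1)\<close> the \<open>k\<close>-th power yields the reflection that swaps the two generators.
\<close>

lemma refl_pair_power:
  fixes \<theta> :: real
  assumes a: "B a a = 1" and b: "B b b = 1" and ab: "B a b = - cos \<theta>" and s0: "sin \<theta> \<noteq> 0"
  shows "((\<lambda>v. refl a (refl b v)) ^^ n) v = v
    - (sin (real n * \<theta>) * (2 * B v a * sin (real n * \<theta>) + 2 * B v b * sin ((real n + 1) * \<theta>)) / (sin \<theta>)\<^sup>2) *\<^sub>R a
    - (sin (real n * \<theta>) * (2 * B v a * sin ((real n - 1) * \<theta>) + 2 * B v b * sin (real n * \<theta>)) / (sin \<theta>)\<^sup>2) *\<^sub>R b"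
proof (induction n)
  case 0
  then show ?case by simp
next
  case (Suc n)
  define s e C D where sC: "s = sin (real n * \<theta>)" "e = sin ((real n + 1) * \<theta>)" "C = cos \<theta>" "D = (sin \<theta>)\<^sup>2"
  (* With s and e the sines of two consecutive multiples of the angle, the neighbouring sines are
     2Cs - e and 2Ce - s, and the only trigonometric fact left to use is the identity K below. *)
  define p q where pq: "p = 2 * B v a" "q = 2 * B v b"
  have ba: "B b a = - C" "B a b = - C" using ab B_sym[of b a] sC by simp_all
  have D0: "D \<noteq> 0" using s0 sC by simp
  have e: "e = s * C + cos (real n * \<theta>) * sin \<theta>"
    by (simp add: sC distrib_right sin_add)
  have e2: "sin ((real n - 1) * \<theta>) = 2 * C * s - e"
    by (simp add: e sC(1,3) left_diff_distrib sin_diff)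
  have "sin ((real n + 2) * \<theta>) + s = sin ((real n + 1) * \<theta> + \<theta>) + sin ((real n + 1) * \<theta> - \<theta>)"
    by (simp add: sC(1) algebra_simps)
  also have "\<dots> = 2 * C * e"
    unfolding sin_add[of _ \<theta>] sin_diff[of _ \<theta>] sC(2,3) by simp
  finally have e3: "sin ((real n + 2) * \<theta>) = 2 * C * e - s" by simp
  have "e\<^sup>2 + s\<^sup>2 - 2 * C * e * s = s\<^sup>2 * (1 - C\<^sup>2) + (cos (real n * \<theta>))\<^sup>2 * D"
    unfolding e by (simp add: sC(4) power2_eq_square algebra_simps)
  also have "1 - C\<^sup>2 = D" using sin_cos_squared_add[of \<theta>] by (simp add: sC(3,4) algebra_simps)
  also have "s\<^sup>2 * D + (cos (real n * \<theta>))\<^sup>2 * D = D"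
    using sin_cos_squared_add[of "n * \<theta>"] by (simp add: sC(1) distrib_right[symmetric])
  finally have K: "e\<^sup>2 + s\<^sup>2 - 2 * C * e * s = D" .
  define X Y where XY: "X = s * (p * s + q * e) / D"
    "Y = s * (p * (2 * C * s - e) + q * s) / D"
  define X' Y' where XY': "X' = e * (p * e + q * (2 * C * e - s)) / D"
    "Y' = e * (p * s + q * e) / D"
  have IH: "((\<lambda>v. refl a (refl b v)) ^^ n) v = v - X *\<^sub>R a - Y *\<^sub>R b"
    using Suc unfolding e2 sC(1,2,4)[symmetric] pq[symmetric] XY .
  define Z where "Z = q + 2 * C * X - 2 * Y"
  have "2 * B (v - X *\<^sub>R a - Y *\<^sub>R b) b = Z"
    using b ba by (simp add: B_linear pq Z_def)
  then have step_b: "refl b (v - X *\<^sub>R a - Y *\<^sub>R b) = v - X *\<^sub>R a - (Y + Z) *\<^sub>R b"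
    using b by (simp add: refl_unit scaleR_add_left)
  have "Y' + Y - 2 * C * X = q * ((e\<^sup>2 + s\<^sup>2 - 2 * C * e * s) / D)"
    using D0 unfolding XY XY' by (simp add: field_simps power2_eq_square)
  then have y: "Y + Z = Y'" using D0 by (simp add: K Z_def)
  have "2 * B (v - X *\<^sub>R a - Y' *\<^sub>R b) a = p - 2 * X + 2 * C * Y'"
    using a ba by (simp add: B_linear pq)
  then have step_a: "refl a (v - X *\<^sub>R a - Y' *\<^sub>R b) = v - (X + (p - 2 * X + 2 * C * Y')) *\<^sub>R a - Y' *\<^sub>R b"
    using a unfolding scaleR_add_left[of X] by (simp add: refl_unit)
  have "X' + X - 2 * C * Y' = p * ((e\<^sup>2 + s\<^sup>2 - 2 * C * e * s) / D)"
    using D0 unfolding XY XY' by (simp add: field_simps power2_eq_square)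
  then have x: "X + (p - 2 * X + 2 * C * Y') = X'" using D0 by (simp add: K)
  have "((\<lambda>v. refl a (refl b v)) ^^ Suc n) v = v - X' *\<^sub>R a - Y' *\<^sub>R b"
    by (simp add: IH step_b y step_a x)
  moreover have "real (Suc n) = real n + 1" "real n + 1 + 1 = real n + 2" "real n + 1 - 1 = real n"
    by auto
  ultimately show ?case
    unfolding XY' by (simp only: e3 sC(1,2,4)[symmetric] pq[symmetric])
qed

end

section \<open>The action of a Coxeter group and reflection length\<close>

text \<open>
  The matrix dictates the inner products of the simple roots only. The space may be larger than
  their span, which leaves room for a nondegenerate form whatever the matrix is.
\<close>

locale coxeter_representation = symmetric_form B
  for B :: "'v::real_vector \<Rightarrow> 'v \<Rightarrow> real" +
  fixes W :: "('a, 'b) monoid_scheme" (structure)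
    and S :: "'a set" and m :: "'a \<Rightarrow> 'a \<Rightarrow> nat" and \<alpha> :: "'a \<Rightarrow> 'v"
  assumes coxeter: "coxeter_system W S m"
    and B_root: "s \<in> S \<Longrightarrow> t \<in> S \<Longrightarrow> m s t \<noteq> 0 \<Longrightarrow> B (\<alpha> s) (\<alpha> t) = - cos (pi / m s t)"
begin

sublocale group W
  using coxeter by (simp add: coxeter_system_def)

lemma m_sym: "s \<in> S \<Longrightarrow> t \<in> S \<Longrightarrow> m s t = m t s"
  and m_eq_1_iff: "s \<in> S \<Longrightarrow> t \<in> S \<Longrightarrow> m s t = 1 \<longleftrightarrow> s = t"
  using coxeter by (auto simp: coxeter_system_def coxeter_matrix_def)

lemma S_closed: "s \<in> S \<Longrightarrow> s \<in> carrier W"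
  using S_carrier[OF coxeter] by blast

lemma root_unit: "s \<in> S \<Longrightarrow> B (\<alpha> s) (\<alpha> s) = 1"
  using B_root[of s s] m_eq_1_iff[of s s] by simp

lemma foldr_refl_replicate:
  "foldr refl (map \<alpha> (concat (replicate n [s, t]))) v = ((\<lambda>v. refl (\<alpha> s) (refl (\<alpha> t) v)) ^^ n) v"
  by (induction n) simp_all

lemma relator_acts_trivially:
  assumes st: "s \<in> S" "t \<in> S"
  shows "foldr refl (map \<alpha> (relator m s t)) v = v"
proof -
  consider "m s t = 0" | "s = t" "m s t = 1" | "m s t \<ge> 2"
    using m_eq_1_iff[OF st] by linarith
  then show ?thesis
  proof cases
    case 3
    have pos: "0 < sin (pi / m s t)" using 3 by (intro sin_gt_zero) (auto simp: field_simps)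
    have zero: "sin (real (m s t) * (pi / m s t)) = 0" using 3 by simp
    have Bst: "B (\<alpha> s) (\<alpha> t) = - cos (pi / m s t)" using st 3 by (intro B_root) auto
    show ?thesis
      unfolding relator_def foldr_refl_replicate
        refl_pair_power[OF root_unit[OF st(1)] root_unit[OF st(2)] Bst less_imp_neq[OF pos, symmetric]] zero
      by simp
  qed (simp_all add: relator_def refl_refl)
qed

lemma word_eq_action:
  "word_eq S m u v \<Longrightarrow> foldr refl (map \<alpha> u) = foldr refl (map \<alpha> v)"
proof (induction rule: word_eq.induct)
  case (word_eq_relator u v s t)
  then show ?case by (simp add: fun_eq_iff relator_acts_trivially)
qed simp_all

text \<open>
  The choice of the word is immaterial by \<open>word_eq_action\<close>.
\<close>

definition rep :: "'a \<Rightarrow> 'v \<Rightarrow> 'v" where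
  "rep w = foldr refl (map \<alpha> (SOME ws. ws \<in> lists S \<and> word_prod W ws = w))"

lemma rep_word_prod:
  assumes "ws \<in> lists S"
  shows "rep (word_prod W ws) = foldr refl (map \<alpha> ws)"
proof -
  let ?us = "SOME us. us \<in> lists S \<and> word_prod W us = word_prod W ws"
  have "?us \<in> lists S \<and> word_prod W ?us = word_prod W ws"
    by (rule someI_ex) (use assms in blast)
  then have "word_eq S m ?us ws"
    using assms coxeter by (auto simp: coxeter_system_def)
  then show ?thesis unfolding rep_def by (rule word_eq_action)
qed

lemma word_prod_Nil: "word_prod W [] = \<one>"
  and word_prod_Cons: "word_prod W (x # xs) = x \<otimes> word_prod W xs"
  by (simp_all add: word_prod_def)

lemma rep_one: "rep \<one> v = v"
  using rep_word_prod[of "[]"] by (simp add: word_prod_def)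

lemma rep_generator: "s \<in> S \<Longrightarrow> rep s = refl (\<alpha> s)"
  using rep_word_prod[of "[s]"] S_closed[of s] by (simp add: word_prod_def fun_eq_iff)

lemma carrier_word:
  assumes "w \<in> carrier W"
  obtains ws where "ws \<in> lists S" "word_prod W ws = w" "rep w = foldr refl (map \<alpha> ws)"
  using generators_word[OF coxeter assms] rep_word_prod that by blast

lemma rep_mult:
  assumes "u \<in> carrier W" "w \<in> carrier W"
  shows "rep (u \<otimes> w) v = rep u (rep w v)"
proof -
  obtain us where us: "us \<in> lists S" "word_prod W us = u" "rep u = foldr refl (map \<alpha> us)"
    using assms(1) by (rule carrier_word)
  obtain ws where ws: "ws \<in> lists S" "word_prod W ws = w" "rep w = foldr refl (map \<alpha> ws)"
    using assms(2) by (rule carrier_word)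
  have "us \<in> lists (carrier W)" "ws \<in> lists (carrier W)" using us(1) ws(1) S_closed by auto
  then have "word_prod W (us @ ws) = u \<otimes> w"
    using word_prod_append[OF coxeter] us(2) ws(2) by simp
  then show ?thesis using rep_word_prod[of "us @ ws"] us ws by auto
qed

lemma rep_pow:
  assumes "u \<in> carrier W"
  shows "rep (u [^] (n::nat)) v = (rep u ^^ n) v"
proof (induction n)
  case (Suc n)
  have "u [^] Suc n = u \<otimes> u [^] n" using assms nat_pow_Suc2 by blast
  with Suc show ?case using assms by (simp add: rep_mult)
qed (simp add: rep_one)

lemma rep_inv: "w \<in> carrier W \<Longrightarrow> rep w (rep (inv w) v) = v"
  using rep_mult[of w "inv w" v] by (simp add: rep_one)

lemma B_rep: "w \<in> carrier W \<Longrightarrow> B (rep w u) (rep w v) = B u v"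
  using B_foldr_refl by (metis carrier_word)

lemma rep_refl: "w \<in> carrier W \<Longrightarrow> rep w (refl b v) = refl (rep w b) (rep w v)"
  using foldr_refl_conjugate by (metis carrier_word)

lemma generator_involution: "s \<in> S \<Longrightarrow> s \<otimes> s = \<one>"
  by (rule generator_square[OF coxeter])

lemma generator_mult_cancel: "s \<in> S \<Longrightarrow> w \<in> carrier W \<Longrightarrow> s \<otimes> (s \<otimes> w) = w"
  using generator_involution S_closed m_assoc[of s s w] by simp

lemma reflections_closed: "t \<in> reflections W S \<Longrightarrow> t \<in> carrier W"
  using reflections_carrier[OF coxeter] by blast

lemma reflection_root:
  assumes "t \<in> reflections W S"
  obtains b where "B b b = 1" "rep t = refl b"
proof -
  obtain w s where w: "w \<in> carrier W" "s \<in> S" "t = w \<otimes> s \<otimes> inv w"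
    using assms by (auto simp: reflections_def)
  have "rep t v = refl (rep w (\<alpha> s)) v" for v
    using w S_closed by (simp add: rep_mult rep_generator rep_refl rep_inv)
  then show thesis using that[of "rep w (\<alpha> s)"] w by (simp add: B_rep root_unit fun_eq_iff)
qed

lemma reflection_involution:
  assumes "t \<in> reflections W S"
  shows "t \<otimes> t = \<one>"
proof -
  obtain w s where w: "w \<in> carrier W" "s \<in> S" "t = w \<otimes> s \<otimes> inv w"
    using assms by (auto simp: reflections_def)
  have "inv w \<otimes> (w \<otimes> (s \<otimes> inv w)) = s \<otimes> inv w"
    using w S_closed by (simp add: m_assoc[symmetric])
  then show ?thesis using w S_closed[of s] generator_mult_cancel[of s "inv w"]
    by (simp add: m_assoc)
qed

lemma reflection_inv: "t \<in> reflections W S \<Longrightarrow> inv t = t"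
  using reflection_involution reflections_closed inv_equality by blast

lemma reflection_mult_cancel:
  "t \<in> reflections W S \<Longrightarrow> w \<in> carrier W \<Longrightarrow> t \<otimes> (t \<otimes> w) = w"
  using reflection_involution reflections_closed m_assoc[of t t w] by simp

lemma generator_reflection: "s \<in> S \<Longrightarrow> s \<in> reflections W S"
  using generators_reflections[OF coxeter] by blast

lemma reflection_conjugate:
  assumes "t \<in> reflections W S" "w \<in> carrier W"
  shows "w \<otimes> t \<otimes> inv w \<in> reflections W S"
proof -
  obtain u s where u: "u \<in> carrier W" "s \<in> S" "t = u \<otimes> s \<otimes> inv u"
    using assms by (auto simp: reflections_def)
  then have "w \<otimes> t \<otimes> inv w = (w \<otimes> u) \<otimes> s \<otimes> inv (w \<otimes> u)"
    using assms(2) S_closed by (simp add: m_assoc inv_mult_group)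
  then show ?thesis using u assms(2) unfolding reflections_def by blast
qed

lemma reflection_conjugate_reflection:
  assumes "t \<in> reflections W S" "u \<in> reflections W S"
  shows "u \<otimes> (t \<otimes> u) \<in> reflections W S"
  using reflection_conjugate[of t u] assms reflections_closed
  by (simp add: reflection_inv m_assoc)

abbreviation len :: "'a \<Rightarrow> nat" where
  "len \<equiv> reflection_length W S"

lemma len_reflection_product:
  "set ts \<subseteq> reflections W S \<Longrightarrow> len (foldr (\<otimes>) ts \<one>) \<le> length ts"
  using reflection_length_le[OF coxeter, of ts] by (auto simp: word_prod_def)

lemma len_witness:
  assumes "w \<in> carrier W"
  obtains ts where "set ts \<subseteq> reflections W S" "length ts = len w" "foldr (\<otimes>) ts \<one> = w"
  using reflection_length_witness[OF coxeter assms] by (auto simp: word_prod_def)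

lemma len_1_reflection:
  assumes "w \<in> carrier W" "len w = 1"
  shows "w \<in> reflections W S"
proof -
  obtain ts where ts: "set ts \<subseteq> reflections W S" "length ts = len w" "foldr (\<otimes>) ts \<one> = w"
    using assms(1) by (rule len_witness)
  then obtain t where "ts = [t]" using assms(2) by (auto simp: length_Suc_conv)
  then show ?thesis using ts reflections_closed by auto
qed

lemma foldr_mult_closed: "set ts \<subseteq> carrier W \<Longrightarrow> foldr (\<otimes>) ts \<one> \<in> carrier W"
  by (induction ts) auto

text \<open>
  Translates factorisations in the group into products of linear reflections, to which
  \<open>card_le_reflections\<close> applies.
\<close>

lemma rep_reflection_product:
  assumes "set ts \<subseteq> reflections W S"
  shows "\<exists>bs. length bs = length ts \<and> rep (foldr (\<otimes>) ts \<one>) = foldr refl bs"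
  using assms
proof (induction ts)
  case Nil
  show ?case by (rule exI[of _ "[]"]) (simp add: rep_one fun_eq_iff)
next
  case (Cons t ts)
  then obtain bs where bs: "length bs = length ts" "rep (foldr (\<otimes>) ts \<one>) = foldr refl bs"
    by auto
  have "t \<in> reflections W S" using Cons.prems by simp
  then obtain b where b: "rep t = refl b" by (rule reflection_root)
  have "foldr (\<otimes>) ts \<one> \<in> carrier W" using Cons.prems reflections_closed by (intro foldr_mult_closed) auto
  then have "rep (foldr (\<otimes>) (t # ts) \<one>) = foldr refl (b # bs)"
    using Cons.prems bs b reflections_closed by (simp add: fun_eq_iff rep_mult)
  then show ?case using bs by (intro exI[of _ "b # bs"]) simp
qed

lemma len_mult:
  "u \<in> carrier W \<Longrightarrow> w \<in> carrier W \<Longrightarrow> len (u \<otimes> w) \<le> len u + len w"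
  by (rule reflection_length_mult[OF coxeter])

lemma absolute_le_mult:
  assumes "u \<in> carrier W" "w \<in> carrier W"
  shows "absolute_le W S u (u \<otimes> w) \<longleftrightarrow> len u + len w = len (u \<otimes> w)"
proof -
  have "inv u \<otimes> (u \<otimes> w) = w" using assms by (simp add: m_assoc[symmetric])
  then show ?thesis by (simp add: absolute_le_def)
qed

lemma generators_commute:
  assumes st: "s \<in> S" "t \<in> S" and m: "m s t = 2"
  shows "s \<otimes> t = t \<otimes> s"
proof -
  have "relator m s t = [s, t, s, t]" using m by (simp add: relator_def numeral_2_eq_2)
  then have "word_eq S m [s, t, s, t] []"
    using word_eq_relator[of "[]" S "[]" s t m] st by simp
  then have "word_prod W [s, t, s, t] = word_prod W []"
    using coxeter st by (auto simp: coxeter_system_def)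
  then have "(s \<otimes> t) \<otimes> (s \<otimes> t) = \<one>"
    using st S_closed by (simp add: word_prod_def m_assoc)
  then have "s \<otimes> t = inv (s \<otimes> t)" using st S_closed inv_equality by simp
  then show ?thesis
    using st S_closed reflection_inv generator_reflection by (simp add: inv_mult_group)
qed

text \<open>
  The longest element \<open>(s t)\<^sup>k s\<close> of an odd dihedral parabolic subgroup. Conjugation by it swaps
  \<open>s\<close> and \<open>t\<close>, and it maps \<open>\<alpha> s\<close> to \<open>- \<alpha> t\<close>, hence its root is \<open>\<alpha> s + \<alpha> t\<close> up to scaling. For an
  even label no element of the subgroup does this.
\<close>

lemma odd_dihedral_reflection:
  assumes st: "s \<in> S" "t \<in> S" and m: "m s t = 2 * k + 1" and k: "k \<ge> 1"
  obtains x where "x \<in> reflections W S" "x \<otimes> s = t \<otimes> x" "rep x = refl (\<alpha> s + \<alpha> t)"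
proof -
  define z where "z = s \<otimes> t"
  have zi: "z \<in> carrier W" "inv z = t \<otimes> s"
    using st S_closed reflection_inv generator_reflection by (simp_all add: z_def inv_mult_group)
  have "word_prod W (concat (replicate n [s, t])) = z [^] n" for n :: nat
  proof (induction n)
    case (Suc n)
    have "z [^] Suc n = z \<otimes> z [^] n" using zi(1) nat_pow_Suc2 by blast
    with Suc show ?case using st S_closed zi(1) by (simp add: word_prod_Cons z_def m_assoc)
  qed (simp add: word_prod_Nil)
  moreover have "word_prod W (relator m s t) = word_prod W []"
  proof -
    have "word_eq S m (relator m s t) []"
      using word_eq_relator[of "[]" S "[]" s t m] st by simp
    moreover have "set (concat (replicate n [s, t])) \<subseteq> S" for n
      using st by (induction n) auto
    then have "relator m s t \<in> lists S" by (simp only: relator_def lists_eq_set mem_Collect_eq)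
    ultimately show ?thesis using coxeter by (auto simp: coxeter_system_def)
  qed
  ultimately have z_order: "z [^] (2 * k + 1) = \<one>"
    using m by (simp only: relator_def word_prod_Nil)
  have s_z: "s \<otimes> inv z [^] n = z [^] n \<otimes> s" for n :: nat
  proof (induction n)
    case (Suc n)
    have "s \<otimes> inv z [^] Suc n = (s \<otimes> inv z [^] n) \<otimes> inv z"
      using st S_closed zi(1) by (simp add: m_assoc)
    also have "\<dots> = z [^] n \<otimes> (s \<otimes> (t \<otimes> s))"
      using Suc st S_closed zi by (simp add: m_assoc)
    also have "\<dots> = z [^] Suc n \<otimes> s"
      using st S_closed zi(1) by (simp add: z_def m_assoc)
    finally show ?case .
  qed (use st S_closed in simp)
  define x where "x = z [^] k \<otimes> s"
  (* Conjugating s by the i-th power of z gives the (2i)-th power of z times s, and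
     2i = k modulo 2k + 1 for this i, whatever the parity of k. *)
  define i where "i = k * (k + 1)"
  have "z [^] i \<otimes> s \<otimes> inv (z [^] i) = z [^] i \<otimes> (s \<otimes> inv z [^] i)"
    using zi(1) st S_closed by (simp add: m_assoc nat_pow_inv)
  also have "\<dots> = z [^] (i + i) \<otimes> s"
    using zi(1) st S_closed by (simp add: s_z m_assoc[symmetric] nat_pow_mult)
  also have "i + i = (2 * k + 1) * k + k" by (simp add: i_def algebra_simps)
  also have "z [^] ((2 * k + 1) * k + k) = z [^] k"
    using zi(1) z_order nat_pow_pow[OF zi(1), of "2 * k + 1" k]
    by (simp only: nat_pow_mult[symmetric]) simp
  finally have "x = z [^] i \<otimes> s \<otimes> inv (z [^] i)" by (simp add: x_def)
  then have x_refl: "x \<in> reflections W S"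
    using zi(1) st generator_reflection reflection_conjugate by simp
  have "x \<otimes> s = z [^] k"
    using zi(1) st S_closed generator_involution by (simp add: x_def m_assoc)
  also have "z [^] k = inv z [^] (k + 1)"
  proof -
    have "z [^] k \<otimes> z [^] (k + 1) = \<one>" using z_order zi(1) nat_pow_mult[of z k "k + 1"] by (simp add: mult_2)
    then have "z [^] k = inv (z [^] (k + 1))" using zi(1) inv_equality nat_pow_closed by presburger
    also have "\<dots> = inv z [^] (k + 1)" using zi(1) by (rule nat_pow_inv[symmetric])
    finally show ?thesis .
  qed
  also have "\<dots> = inv z \<otimes> inv z [^] k" using zi(1) nat_pow_Suc2[of "inv z" k] by simp
  also have "\<dots> = t \<otimes> x"
    using zi st S_closed by (simp add: x_def s_z[symmetric] m_assoc)
  finally have x_s: "x \<otimes> s = t \<otimes> x" .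
  (* The angles (k - 1), k and (k + 1) times \<theta> lie symmetrically around pi / 2 - \<theta> / 2 and
     pi / 2 + \<theta> / 2, so all sines in refl_pair_power are multiples of h. *)
  define \<theta> where "\<theta> = pi / (2 * k + 1)"
  have k\<theta>: "real k * \<theta> = pi / 2 - \<theta> / 2"
    by (simp add: \<theta>_def field_simps)
  have \<theta>: "0 < \<theta>" "\<theta> < pi" using k by (auto simp: \<theta>_def field_simps)
  then have S0: "sin \<theta> > 0" by (rule sin_gt_zero)
  define C h where Ch: "C = cos \<theta>" "h = sin (real k * \<theta>)"
  have h1: "h = cos (\<theta> / 2)"
    unfolding Ch k\<theta> by (simp add: sin_diff)
  have h2: "2 * h\<^sup>2 = 1 + C" using cos_double_cos[of "\<theta> / 2"] by (simp add: h1 Ch(1))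
  have h3: "sin ((real k + 1) * \<theta>) = h"
  proof -
    have "(real k + 1) * \<theta> = pi / 2 + \<theta> / 2" using k\<theta> by (simp add: algebra_simps)
    then show ?thesis by (simp add: sin_add h1)
  qed
  have h4: "sin ((real k - 1) * \<theta>) = h * (2 * C - 1)"
  proof -
    have "sin ((real k - 1) * \<theta>) + sin ((real k + 1) * \<theta>) = 2 * C * h"
      by (simp add: left_diff_distrib distrib_right sin_diff sin_add Ch)
    then show ?thesis unfolding h3 by (simp add: right_diff_distrib mult.commute mult.left_commute)
  qed
  have D: "(sin \<theta>)\<^sup>2 = 2 * h\<^sup>2 * (1 - C)"
    unfolding h2 using sin_cos_squared_add[of \<theta>] by (simp add: Ch power2_eq_square algebra_simps)
  then have nz: "h \<noteq> 0" "C \<noteq> 1" using S0 by auto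
  have Bst: "B (\<alpha> s) (\<alpha> t) = - C" "B (\<alpha> t) (\<alpha> s) = - C"
    using B_root[OF st] B_sym[of "\<alpha> t" "\<alpha> s"] m by (simp_all add: Ch \<theta>_def)
  note units = root_unit[OF st(1)] root_unit[OF st(2)]
  have "rep x v = refl (\<alpha> s + \<alpha> t) v" for v
  proof -
    define p q where pq: "p = B v (\<alpha> s)" "q = B v (\<alpha> t)"
    define u where "u = refl (\<alpha> s) v"
    have u: "u = v - (2 * p) *\<^sub>R \<alpha> s" "B u (\<alpha> s) = - p" "B u (\<alpha> t) = q + 2 * C * p"
      using units Bst by (simp_all add: u_def refl_unit B_linear pq)
    have "rep z = (\<lambda>v. refl (\<alpha> s) (refl (\<alpha> t) v))"
      using st S_closed by (simp add: z_def fun_eq_iff rep_mult rep_generator)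
    then have "rep x v = ((\<lambda>v. refl (\<alpha> s) (refl (\<alpha> t) v)) ^^ k) u"
      using zi(1) st S_closed by (simp add: x_def rep_mult rep_generator rep_pow u_def)
    also have "\<dots> = u
        - (h * (2 * (- p) * h + 2 * (q + 2 * C * p) * h) / (2 * h\<^sup>2 * (1 - C))) *\<^sub>R \<alpha> s
        - (h * (2 * (- p) * (h * (2 * C - 1)) + 2 * (q + 2 * C * p) * h) / (2 * h\<^sup>2 * (1 - C))) *\<^sub>R \<alpha> t"
      using refl_pair_power[of "\<alpha> s" "\<alpha> t" \<theta> k u] units Bst S0
      by (simp only: h3 h4 D Ch[symmetric] u(2,3))
    also have "h * (2 * (- p) * h + 2 * (q + 2 * C * p) * h) / (2 * h\<^sup>2 * (1 - C)) =
        (p + q) / (1 - C) - 2 * p"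
      using nz by (simp add: field_simps power2_eq_square)
    also have "h * (2 * (- p) * (h * (2 * C - 1)) + 2 * (q + 2 * C * p) * h) / (2 * h\<^sup>2 * (1 - C)) =
        (p + q) / (1 - C)"
      using nz by (simp add: field_simps power2_eq_square)
    finally have 1: "rep x v = v - ((p + q) / (1 - C)) *\<^sub>R (\<alpha> s + \<alpha> t)"
      by (simp add: u(1) algebra_simps)
    have "2 * B v (\<alpha> s + \<alpha> t) / B (\<alpha> s + \<alpha> t) (\<alpha> s + \<alpha> t) = (2 * (p + q)) / (2 * (1 - C))"
      using units Bst by (simp add: B_linear pq)
    also have "\<dots> = (p + q) / (1 - C)" by (rule mult_divide_mult_cancel_left) simp
    finally show ?thesis unfolding 1 refl_def by simp
  qed
  then show thesis using that x_refl x_s by blast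
qed

end

section \<open>Coxeter groups whose diagram is a square\<close>

text \<open>
  The reflections \<open>x\<close> and \<open>y\<close> and the dual vectors \<open>\<delta>\<close> are parameters, so that exchanging the two odd
  edges is an instance of the same locale (\<open>swapped\<close>) and everything shown for \<open>s3 x s4\<close> also holds
  for \<open>s1 y s2\<close>.
\<close>

locale square_coxeter_group = coxeter_representation B W S m \<alpha>
  for B :: "'v::real_vector \<Rightarrow> 'v \<Rightarrow> real"
    and W :: "('a, 'b) monoid_scheme" (structure)
    and S :: "'a set" and m :: "'a \<Rightarrow> 'a \<Rightarrow> nat" and \<alpha> :: "'a \<Rightarrow> 'v" +
  fixes \<delta> :: "'a \<Rightarrow> 'v" and s1 s2 s3 s4 :: 'a and k k' l :: nat and x y :: 'a
  assumes B_dual: "s \<in> S \<Longrightarrow> t \<in> S \<Longrightarrow> B (\<delta> s) (\<alpha> t) = (if s = t then 1 else 0)"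
    and S_eq: "S = {s1, s2, s3, s4}" and card_S: "card S = 4"
    and k: "k \<ge> 1" "k' \<ge> 1" and l: "l \<ge> 3"
    and edges: "m s1 s2 = 2 * k + 1" "m s2 s3 = l" "m s3 s4 = 2 * k' + 1" "m s4 s1 = l"
    and diagonals: "m s1 s3 = 2" "m s2 s4 = 2"
    and x: "x \<in> reflections W S" "x \<otimes> s1 = s2 \<otimes> x" "rep x = refl (\<alpha> s1 + \<alpha> s2)"
    and y: "y \<in> reflections W S" "y \<otimes> s3 = s4 \<otimes> y" "rep y = refl (\<alpha> s3 + \<alpha> s4)"
begin

lemma gens [simp]: "s1 \<in> S" "s2 \<in> S" "s3 \<in> S" "s4 \<in> S"
  by (simp_all add: S_eq)

lemma closed [simp]: "s1 \<in> carrier W" "s2 \<in> carrier W" "s3 \<in> carrier W" "s4 \<in> carrier W"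
  "x \<in> carrier W" "y \<in> carrier W"
  using x(1) y(1) S_closed reflections_closed by simp_all

lemma refls [simp]: "s1 \<in> reflections W S" "s2 \<in> reflections W S" "s3 \<in> reflections W S"
  "s4 \<in> reflections W S" "x \<in> reflections W S" "y \<in> reflections W S"
  using x(1) y(1) by (simp_all add: generator_reflection)

lemma distinct: "s1 \<noteq> s2" "s1 \<noteq> s3" "s1 \<noteq> s4" "s2 \<noteq> s3" "s2 \<noteq> s4" "s3 \<noteq> s4"
proof -
  have "card (set [s1, s2, s3, s4]) = length [s1, s2, s3, s4]" using card_S S_eq by simp
  then have "distinct [s1, s2, s3, s4]" by (rule card_distinct)
  then show "s1 \<noteq> s2" "s1 \<noteq> s3" "s1 \<noteq> s4" "s2 \<noteq> s3" "s2 \<noteq> s4" "s3 \<noteq> s4" by auto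
qed

definition C1 :: real where "C1 = cos (pi / (2 * k + 1))"
definition C2 :: real where "C2 = cos (pi / (2 * k' + 1))"
definition L :: real where "L = cos (pi / l)"

lemma B_roots:
  "B (\<alpha> s1) (\<alpha> s1) = 1" "B (\<alpha> s2) (\<alpha> s2) = 1" "B (\<alpha> s3) (\<alpha> s3) = 1" "B (\<alpha> s4) (\<alpha> s4) = 1"
  "B (\<alpha> s1) (\<alpha> s2) = - C1" "B (\<alpha> s2) (\<alpha> s1) = - C1"
  "B (\<alpha> s3) (\<alpha> s4) = - C2" "B (\<alpha> s4) (\<alpha> s3) = - C2"
  "B (\<alpha> s2) (\<alpha> s3) = - L" "B (\<alpha> s3) (\<alpha> s2) = - L"
  "B (\<alpha> s4) (\<alpha> s1) = - L" "B (\<alpha> s1) (\<alpha> s4) = - L"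
  "B (\<alpha> s1) (\<alpha> s3) = 0" "B (\<alpha> s3) (\<alpha> s1) = 0"
  "B (\<alpha> s2) (\<alpha> s4) = 0" "B (\<alpha> s4) (\<alpha> s2) = 0"
proof -
  show 1: "B (\<alpha> s1) (\<alpha> s2) = - C1" "B (\<alpha> s3) (\<alpha> s4) = - C2" "B (\<alpha> s2) (\<alpha> s3) = - L"
    "B (\<alpha> s4) (\<alpha> s1) = - L" "B (\<alpha> s1) (\<alpha> s3) = 0" "B (\<alpha> s2) (\<alpha> s4) = 0"
    using l edges diagonals B_root[of s1 s2] B_root[of s3 s4] B_root[of s2 s3] B_root[of s4 s1]
      B_root[of s1 s3] B_root[of s2 s4]
    by (simp_all add: C1_def C2_def L_def)
  show "B (\<alpha> s2) (\<alpha> s1) = - C1" "B (\<alpha> s4) (\<alpha> s3) = - C2" "B (\<alpha> s3) (\<alpha> s2) = - L"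
    "B (\<alpha> s1) (\<alpha> s4) = - L" "B (\<alpha> s3) (\<alpha> s1) = 0" "B (\<alpha> s4) (\<alpha> s2) = 0"
    using 1 B_sym[of "\<alpha> s2" "\<alpha> s1"] B_sym[of "\<alpha> s4" "\<alpha> s3"] B_sym[of "\<alpha> s3" "\<alpha> s2"]
      B_sym[of "\<alpha> s1" "\<alpha> s4"] B_sym[of "\<alpha> s3" "\<alpha> s1"] B_sym[of "\<alpha> s4" "\<alpha> s2"] by simp_all
qed (simp_all add: root_unit)

lemma B_duals:
  "B (\<delta> s1) (\<alpha> s1) = 1" "B (\<delta> s1) (\<alpha> s2) = 0" "B (\<delta> s1) (\<alpha> s3) = 0" "B (\<delta> s1) (\<alpha> s4) = 0"
  "B (\<delta> s2) (\<alpha> s1) = 0" "B (\<delta> s2) (\<alpha> s2) = 1" "B (\<delta> s2) (\<alpha> s3) = 0" "B (\<delta> s2) (\<alpha> s4) = 0"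
  "B (\<delta> s3) (\<alpha> s1) = 0" "B (\<delta> s3) (\<alpha> s2) = 0" "B (\<delta> s3) (\<alpha> s3) = 1" "B (\<delta> s3) (\<alpha> s4) = 0"
  "B (\<delta> s4) (\<alpha> s1) = 0" "B (\<delta> s4) (\<alpha> s2) = 0" "B (\<delta> s4) (\<alpha> s3) = 0" "B (\<delta> s4) (\<alpha> s4) = 1"
  using distinct by (simp_all add: B_dual)

lemma cosine_bounds: "1 / 2 \<le> C1" "C1 < 1" "1 / 2 \<le> C2" "C2 < 1" "1 / 2 \<le> L"
proof -
  have half: "1 / 2 \<le> cos (pi / r)" if "r \<ge> 3" for r :: real
  proof -
    have "cos (pi / 3) \<le> cos (pi / r)"
      using that by (intro cos_monotone_0_pi_le) (auto simp: field_simps)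
    then show ?thesis by (simp add: cos_60)
  qed
  have less: "cos (pi / r) < 1" if "r \<ge> 3" for r :: real
    using that cos_monotone_0_pi[of 0 "pi / r"] by (auto simp: field_simps)
  have r: "3 \<le> real (2 * k + 1)" "3 \<le> real (2 * k' + 1)" "3 \<le> real l"
    using k l by simp_all
  show "1 / 2 \<le> C1" "C1 < 1" "1 / 2 \<le> C2" "C2 < 1" "1 / 2 \<le> L"
    using half[OF r(1)] half[OF r(2)] half[OF r(3)] less[OF r(1)] less[OF r(2)]
    by (simp_all only: C1_def C2_def L_def)
qed

lemma commute: "s1 \<otimes> s3 = s3 \<otimes> s1" "s2 \<otimes> s4 = s4 \<otimes> s2"
  by (rule generators_commute, simp, simp, rule diagonals)+

lemma cancel [simp]:
  assumes "w \<in> carrier W"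
  shows "s1 \<otimes> (s1 \<otimes> w) = w" "s2 \<otimes> (s2 \<otimes> w) = w" "s3 \<otimes> (s3 \<otimes> w) = w"
    "s4 \<otimes> (s4 \<otimes> w) = w" "x \<otimes> (x \<otimes> w) = w" "y \<otimes> (y \<otimes> w) = w"
  using assms by (simp_all add: reflection_mult_cancel)

definition cox :: 'a where "cox = s3 \<otimes> s1 \<otimes> s2 \<otimes> s4"

definition upper :: 'a where "upper = s3 \<otimes> (x \<otimes> s4)"

lemma cox_closed [simp]: "cox \<in> carrier W" and upper_closed [simp]: "upper \<in> carrier W"
  by (simp_all add: cox_def upper_def)

lemma rep_cox: "rep cox v = refl (\<alpha> s3) (refl (\<alpha> s1) (refl (\<alpha> s2) (refl (\<alpha> s4) v)))"
  by (simp add: cox_def m_assoc rep_mult rep_generator)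

lemma rep_upper: "rep upper v = refl (\<alpha> s3) (refl (\<alpha> s1 + \<alpha> s2) (refl (\<alpha> s4) v))"
  by (simp add: upper_def rep_mult rep_generator x(3))

text \<open>
  The four simple roots appear, in triangular form, as displacements of the dual vectors.
\<close>

lemma cox_full_rank:
  assumes "\<And>v. rep cox v = foldr refl bs v"
  shows "4 \<le> length bs"
proof -
  let ?V = "span (range (\<lambda>v. rep cox v - v))"
  note B_simps = refl_unit B_linear B_roots B_duals
  have V: "rep cox v - v \<in> ?V" for v by (rule span_base) simp
  have "- 2 *\<^sub>R \<alpha> s3 \<in> ?V"
    using V[of "\<delta> s3"] by (simp add: rep_cox B_simps)
  then have 3: "\<alpha> s3 \<in> ?V" using span_scale[of _ _ "- 1 / 2"] by fastforce
  have "- 2 *\<^sub>R \<alpha> s1 \<in> ?V"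
    using V[of "\<delta> s1"] by (simp add: rep_cox B_simps)
  then have 1: "\<alpha> s1 \<in> ?V" using span_scale[of _ _ "- 1 / 2"] by fastforce
  have "rep cox (\<delta> s2) - \<delta> s2 = - 2 *\<^sub>R \<alpha> s2 - (4 * L) *\<^sub>R \<alpha> s3 - (4 * C1) *\<^sub>R \<alpha> s1"
    by (simp add: rep_cox B_simps)
  then have "- 2 *\<^sub>R \<alpha> s2 - (4 * L) *\<^sub>R \<alpha> s3 - (4 * C1) *\<^sub>R \<alpha> s1 \<in> ?V"
    using V[of "\<delta> s2"] by simp
  then have "(- 1 / 2) *\<^sub>R ((- 2 *\<^sub>R \<alpha> s2 - (4 * L) *\<^sub>R \<alpha> s3 - (4 * C1) *\<^sub>R \<alpha> s1)
      + ((4 * L) *\<^sub>R \<alpha> s3 + (4 * C1) *\<^sub>R \<alpha> s1)) \<in> ?V"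
    using 1 3 by (intro span_scale span_add)
  then have 2: "\<alpha> s2 \<in> ?V" by simp
  have "rep cox (\<delta> s4) - \<delta> s4 = - 2 *\<^sub>R \<alpha> s4 - (4 * L) *\<^sub>R \<alpha> s1 - (4 * C2) *\<^sub>R \<alpha> s3"
    by (simp add: rep_cox B_simps)
  then have "- 2 *\<^sub>R \<alpha> s4 - (4 * L) *\<^sub>R \<alpha> s1 - (4 * C2) *\<^sub>R \<alpha> s3 \<in> ?V"
    using V[of "\<delta> s4"] by simp
  then have "(- 1 / 2) *\<^sub>R ((- 2 *\<^sub>R \<alpha> s4 - (4 * L) *\<^sub>R \<alpha> s1 - (4 * C2) *\<^sub>R \<alpha> s3)
      + ((4 * L) *\<^sub>R \<alpha> s1 + (4 * C2) *\<^sub>R \<alpha> s3)) \<in> ?V"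
    using 1 3 by (intro span_scale span_add)
  then have 4: "\<alpha> s4 \<in> ?V" by simp
  have "\<alpha> ` S \<subseteq> ?V" using 1 2 3 4 by (simp add: S_eq)
  then have "card (\<alpha> ` S) \<le> length bs"
    using dual_basis_independent[of S \<delta> \<alpha>] B_dual assms
    by (intro card_le_reflections) auto
  then show ?thesis
    using dual_basis_inj[of S \<delta> \<alpha>] B_dual card_S by (simp add: card_image)
qed

lemma len_cox: "len cox = 4"
proof (rule antisym)
  show "len cox \<le> 4"
    using len_reflection_product[of "[s3, s1, s2, s4]"] by (simp add: cox_def m_assoc)
  obtain ts where ts: "set ts \<subseteq> reflections W S" "length ts = len cox" "foldr (\<otimes>) ts \<one> = cox"
    using cox_closed by (rule len_witness)
  then obtain bs where "length bs = length ts" "rep cox = foldr refl bs"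
    using rep_reflection_product by metis
  then show "4 \<le> len cox" using cox_full_rank[of bs] ts(2) by simp
qed

text \<open>
  Since \<open>x s2 x = s1\<close>, one has \<open>s1 s2 = x s2 x s2\<close>, and moving \<open>s4\<close> to the left past the
  reflection \<open>s2 x s2\<close> replaces the latter by a conjugate.
\<close>

lemma cox_upper:
  obtains q where "q \<in> reflections W S" "cox = upper \<otimes> q"
proof -
  have "x \<otimes> (s2 \<otimes> x) = s1"
    using x(2) cancel(5)[of s1] by simp
  then have "s1 \<otimes> (s2 \<otimes> s4) = x \<otimes> (s2 \<otimes> (x \<otimes> (s2 \<otimes> s4)))"
    by (metis closed m_assoc m_closed)
  then have "cox = upper \<otimes> (s4 \<otimes> ((s2 \<otimes> (x \<otimes> s2)) \<otimes> s4))"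
    by (simp add: cox_def upper_def m_assoc)
  moreover have "s4 \<otimes> ((s2 \<otimes> (x \<otimes> s2)) \<otimes> s4) \<in> reflections W S"
    by (simp add: reflection_conjugate_reflection)
  ultimately show thesis using that by blast
qed

lemma len_upper: "len upper = 3" and upper_le_cox: "absolute_le W S upper cox"
proof -
  obtain q where q: "q \<in> reflections W S" "cox = upper \<otimes> q" by (rule cox_upper)
  have "len upper \<le> 3"
    using len_reflection_product[of "[s3, x, s4]"] by (simp add: upper_def)
  moreover have "len q \<le> 1"
    using len_reflection_product[of "[q]"] q reflections_closed by simp
  moreover have "4 \<le> len upper + len q"
    using len_mult[of upper q] q reflections_closed len_cox by simp
  ultimately show "len upper = 3" "absolute_le W S upper cox"
    using q reflections_closed len_cox by (simp_all add: absolute_le_mult)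
qed

text \<open>
  Since \<open>upper\<close> has length 3, a factorisation into three reflections is reduced and its first factor
  lies below.
\<close>

lemma reflection_le_upper:
  assumes t: "t \<in> reflections W S" "r \<in> reflections W S" "u \<in> reflections W S"
    and eq: "upper = t \<otimes> (r \<otimes> u)"
  shows "len t = 1" and "absolute_le W S t upper"
proof -
  note closed = t[THEN reflections_closed]
  have "len t \<le> 1" "len (r \<otimes> u) \<le> 2"
    using len_reflection_product[of "[t]"] len_reflection_product[of "[r, u]"] t closed by simp_all
  moreover have "3 \<le> len t + len (r \<otimes> u)"
    using len_mult[of t "r \<otimes> u"] closed len_upper eq by simp
  ultimately show "len t = 1" "absolute_le W S t upper"
    using closed len_upper unfolding eq by (simp_all add: absolute_le_mult)
qed

lemma x_le_upper: "len x = 1" "absolute_le W S x upper"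
proof -
  have "upper = x \<otimes> ((x \<otimes> (s3 \<otimes> x)) \<otimes> s4)" by (simp add: upper_def m_assoc)
  then show "len x = 1" "absolute_le W S x upper"
    using reflection_le_upper[of x "x \<otimes> (s3 \<otimes> x)" s4] by (simp_all add: reflection_conjugate_reflection)
qed

lemma y_le_upper: "len y = 1" "absolute_le W S y upper"
proof -
  have "s3 = y \<otimes> (s4 \<otimes> y)" using y(2) cancel(6)[of s3] by simp
  then have "s3 \<otimes> (x \<otimes> s4) = y \<otimes> (s4 \<otimes> (y \<otimes> (x \<otimes> s4)))"
    by (metis closed m_assoc m_closed)
  then have "upper = y \<otimes> ((s4 \<otimes> (y \<otimes> s4)) \<otimes> (s4 \<otimes> (x \<otimes> s4)))"
    by (simp add: upper_def m_assoc)
  then show "len y = 1" "absolute_le W S y upper"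
    using reflection_le_upper[of y "s4 \<otimes> (y \<otimes> s4)" "s4 \<otimes> (x \<otimes> s4)"]
    by (simp_all add: reflection_conjugate_reflection)
qed

text \<open>
  The heart of the matter: the root \<open>\<gamma>\<close> of \<open>r = x\<inverse> j\<close> would lie in two planes whose intersection
  contains no vector of positive norm.
\<close>

lemma no_bound_of_length_2:
  assumes j: "j \<in> carrier W" "len j = 2"
    and le: "absolute_le W S x j" "absolute_le W S y j" "absolute_le W S j upper"
  shows False
proof -
  define N where "N = B (\<alpha> s1 + \<alpha> s2) (\<alpha> s1 + \<alpha> s2)"
  have N: "N = 2 - 2 * C1" by (simp add: N_def B_linear B_roots)
  then have N_pos: "N > 0" using cosine_bounds by simp
  have Ny: "B (\<alpha> s3 + \<alpha> s4) (\<alpha> s3 + \<alpha> s4) \<noteq> 0"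
    using cosine_bounds by (simp add: B_linear B_roots)
  have step: "inv u \<otimes> w \<in> reflections W S \<and> u \<otimes> (inv u \<otimes> w) = w"
    if "u \<in> carrier W" "w \<in> carrier W" "absolute_le W S u w" "len w = len u + 1" for u w
    using that len_1_reflection[of "inv u \<otimes> w"]
    by (simp add: absolute_le_def m_assoc[symmetric])
  obtain r where r: "r \<in> reflections W S" "x \<otimes> r = j"
    using step[of x j] j le x_le_upper by auto
  obtain r' where r': "r' \<in> reflections W S" "y \<otimes> r' = j"
    using step[of y j] j le y_le_upper by auto
  obtain t where t: "t \<in> reflections W S" "j \<otimes> t = upper"
    using step[of j upper] j le len_upper by auto
  obtain q where q: "q \<in> reflections W S" "cox = upper \<otimes> q" by (rule cox_upper)
  note closed' = r(1)[THEN reflections_closed] r'(1)[THEN reflections_closed]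
    t(1)[THEN reflections_closed] q(1)[THEN reflections_closed]
  obtain \<gamma> where \<gamma>: "B \<gamma> \<gamma> = 1" "rep r = refl \<gamma>" using r(1) by (rule reflection_root)
  obtain \<gamma>' where \<gamma>': "B \<gamma>' \<gamma>' = 1" "rep r' = refl \<gamma>'" using r'(1) by (rule reflection_root)
  obtain \<tau> where \<tau>: "B \<tau> \<tau> = 1" "rep t = refl \<tau>" using t(1) by (rule reflection_root)
  obtain \<kappa> where \<kappa>: "B \<kappa> \<kappa> = 1" "rep q = refl \<kappa>" using q(1) by (rule reflection_root)
  have rep_j: "rep j v = refl (\<alpha> s1 + \<alpha> s2) (refl \<gamma> v)" for v
    unfolding r(2)[symmetric] using closed' by (simp add: rep_mult x(3) \<gamma>)
  have rep_j': "rep j v = refl (\<alpha> s3 + \<alpha> s4) (refl \<gamma>' v)" for v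
    unfolding r'(2)[symmetric] using closed' by (simp add: rep_mult y(3) \<gamma>')
  have rep_w: "rep upper v = rep j (refl \<tau> v)" for v
    unfolding t(2)[symmetric] using closed' j by (simp add: rep_mult \<tau>)
  have rep_c: "rep cox v = rep upper (refl \<kappa> v)" for v
    unfolding q(2) using closed' by (simp add: rep_mult \<kappa>)
  (* If j or r t acted trivially, then the Coxeter element would act as a product of two
     reflections. This replaces an appeal to faithfulness of the representation. *)
  have "\<exists>v. rep j v \<noteq> v"
  proof (rule ccontr)
    assume "\<not> ?thesis"
    then have "rep cox v = foldr refl [\<tau>, \<kappa>] v" for v by (simp add: rep_c rep_w)
    then show False using cox_full_rank by fastforce
  qed
  then have "\<alpha> s3 + \<alpha> s4 \<in> span {\<alpha> s1 + \<alpha> s2, \<gamma>}"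
    using Ny \<gamma>'(1) rep_j rep_j' by (intro refl_pair_root_in_span[of _ \<gamma>']) auto
  then obtain p1 p2 where p: "\<alpha> s3 + \<alpha> s4 = p1 *\<^sub>R (\<alpha> s1 + \<alpha> s2) + p2 *\<^sub>R \<gamma>"
    by (rule in_span_pair_obtain)
  (* Passing x through upper = s3 x s4 turns the remaining product r t into (x s3 x) s4. *)
  define e where "e = 2 * L / N"
  have \<alpha>3: "refl (\<alpha> s1 + \<alpha> s2) (\<alpha> s3) = \<alpha> s3 + e *\<^sub>R (\<alpha> s1 + \<alpha> s2)"
    by (simp add: refl_def N_def[symmetric]) (simp add: e_def B_linear B_roots)
  have eq: "refl \<gamma> (refl \<tau> v) = refl (\<alpha> s3 + e *\<^sub>R (\<alpha> s1 + \<alpha> s2)) (refl (\<alpha> s4) v)" for v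
  proof -
    have "refl \<gamma> (refl \<tau> v) = refl (\<alpha> s1 + \<alpha> s2) (rep upper v)"
      by (simp add: rep_w rep_j refl_refl)
    also have "\<dots> = refl (refl (\<alpha> s1 + \<alpha> s2) (\<alpha> s3))
        (refl (\<alpha> s1 + \<alpha> s2) (refl (\<alpha> s1 + \<alpha> s2) (refl (\<alpha> s4) v)))"
      unfolding rep_upper by (rule refl_conjugate)
    finally show ?thesis by (simp add: refl_refl \<alpha>3)
  qed
  have "\<exists>v. refl \<gamma> (refl \<tau> v) \<noteq> v"
  proof (rule ccontr)
    assume "\<not> ?thesis"
    then have "rep cox v = foldr refl [\<alpha> s1 + \<alpha> s2, \<kappa>] v" for v by (simp add: rep_c rep_w rep_j)
    then show False using cox_full_rank by fastforce
  qed
  then have "\<gamma> \<in> span {\<alpha> s3 + e *\<^sub>R (\<alpha> s1 + \<alpha> s2), \<alpha> s4}"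
    using \<gamma>(1) \<tau>(1) eq by (intro refl_pair_root_in_span[of _ \<tau>]) auto
  then obtain u v where uv: "\<gamma> = u *\<^sub>R (\<alpha> s3 + e *\<^sub>R (\<alpha> s1 + \<alpha> s2)) + v *\<^sub>R \<alpha> s4"
    by (rule in_span_pair_obtain)
  (* Comparing coefficients of s3 and s4 forces \<gamma> to be a multiple of
     (\<alpha> s3 + \<alpha> s4) + e (\<alpha> s1 + \<alpha> s2). *)
  have "p2 * u = 1" "p2 * v = 1"
    using arg_cong[OF p, of "B (\<delta> s3)"] arg_cong[OF p, of "B (\<delta> s4)"]
    by (simp_all add: uv B_linear B_duals)
  then have "u = v" by (metis mult_cancel_left mult_zero_left zero_neq_one)
  then have "B \<gamma> \<gamma> = u\<^sup>2 * (2 - 2 * C2 + e * (e * (2 - 2 * C1)) - 4 * e * L)"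
    by (simp add: uv B_linear B_roots power2_eq_square algebra_simps)
  also have "e * (2 - 2 * C1) = 2 * L" using N_pos by (simp add: e_def N[symmetric])
  finally have norm: "B \<gamma> \<gamma> = u\<^sup>2 * (2 - 2 * C2 - 2 * (e * L))" by (simp add: algebra_simps)
  have "(2 - 2 * C2) * N \<le> 1 * 1"
    using cosine_bounds N N_pos by (intro mult_mono) auto
  also have "1 * 1 \<le> (2 * L) * (2 * L)"
    using cosine_bounds by (intro mult_mono) auto
  finally have "2 - 2 * C2 \<le> (2 * L) * (2 * L) / N" using N_pos by (simp add: pos_le_divide_eq)
  also have "\<dots> = 2 * (e * L)" by (simp add: e_def)
  finally have "B \<gamma> \<gamma> \<le> 0" unfolding norm by (intro mult_nonneg_nonpos) auto
  then show False using \<gamma>(1) by simp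
qed

lemma swapped: "square_coxeter_group B W S m \<alpha> \<delta> s3 s4 s1 s2 k' k l y x"
proof -
  have S': "S = {s3, s4, s1, s2}" using S_eq by auto
  have diagonals': "m s3 s1 = 2" "m s4 s2 = 2"
    using diagonals m_sym[of s3 s1] m_sym[of s4 s2] by simp_all
  show ?thesis
    by unfold_locales (fact B_dual S' card_S k l edges diagonals' x y)+
qed

text \<open>
  The two elements are told apart by the \<open>\<alpha> s2\<close>-component of the displacement of \<open>\<delta> s1\<close>: it is
  nonzero for \<open>s3 x s4\<close>, through the root of \<open>x\<close>, and zero for \<open>s1 y s2\<close>. Pairing with \<open>\<delta> s2\<close>
  extracts it.
\<close>

lemma upper_neq_swapped: "upper \<noteq> s1 \<otimes> (y \<otimes> s2)"
proof
  assume eq: "upper = s1 \<otimes> (y \<otimes> s2)"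
  have nz: "2 - 2 * C1 \<noteq> 0" using cosine_bounds by simp
  have "B (rep upper (\<delta> s1)) (\<delta> s2) = B (rep (s1 \<otimes> (y \<otimes> s2)) (\<delta> s1)) (\<delta> s2)"
    by (simp add: eq)
  moreover have "B (rep upper (\<delta> s1)) (\<delta> s2) = B (\<delta> s1) (\<delta> s2) - 2 / (2 - 2 * C1)"
    using B_sym[of "\<alpha> s1" "\<delta> s2"] B_sym[of "\<alpha> s2" "\<delta> s2"] B_sym[of "\<alpha> s3" "\<delta> s2"]
    by (simp add: rep_upper refl_def B_linear B_roots B_duals)
  moreover have "B (rep (s1 \<otimes> (y \<otimes> s2)) (\<delta> s1)) (\<delta> s2) = B (\<delta> s1) (\<delta> s2)"
    using B_sym[of "\<alpha> s1" "\<delta> s2"]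
    by (simp add: rep_mult rep_generator y(3) refl_def B_linear B_roots B_duals)
  ultimately show False using nz by simp
qed

lemma x_neq_y: "x \<noteq> y"
proof
  assume "x = y"
  then have "B (rep x (\<delta> s1)) (\<delta> s1) = B (rep y (\<delta> s1)) (\<delta> s1)" by simp
  then show False
    using B_sym[of "\<alpha> s1" "\<delta> s1"] B_sym[of "\<alpha> s2" "\<delta> s1"] cosine_bounds
    by (simp add: x(3) y(3) refl_def B_linear B_roots B_duals)
qed

text \<open>
  A join of \<open>x\<close> and \<open>y\<close> has a length between 1 and 3; the lengths 1 and 3 would identify the two
  lower or the two upper elements, and \<open>no_bound_of_length_2\<close> rules out the remaining one.
\<close>

lemma not_lattice: "\<not> lattice (absolute_interval W S cox)"
proof
  let ?L = "absolute_interval W S cox"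
  assume "lattice ?L"
  interpret sw: square_coxeter_group B W S m \<alpha> \<delta> s3 s4 s1 s2 k' k l y x
    by (rule swapped)
  have sw_cox: "sw.cox = cox"
    unfolding sw.cox_def cox_def by (simp add: m_assoc commute)
  have sw_upper: "sw.upper = s1 \<otimes> (y \<otimes> s2)" by (simp add: sw.upper_def)
  have le: "absolute_le W S x upper" "absolute_le W S y upper" "absolute_le W S upper cox"
    "absolute_le W S x sw.upper" "absolute_le W S y sw.upper" "absolute_le W S sw.upper cox"
    using x_le_upper(2) y_le_upper(2) upper_le_cox sw.x_le_upper(2) sw.y_le_upper(2)
      sw.upper_le_cox sw_cox by simp_all
  have xc: "absolute_le W S x cox" "absolute_le W S y cox"
    using absolute_le_trans[OF coxeter] le closed upper_closed cox_closed by blast+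
  have mem: "w \<in> carrier ?L \<longleftrightarrow> w \<in> carrier W \<and> absolute_le W S w cox" for w
    by (simp add: absolute_interval_def)
  have leL: "le ?L = absolute_le W S" by (simp add: absolute_interval_def)
  obtain j where j: "least ?L j (Upper ?L {x, y})"
    using upper_semilattice.sup_of_two_exists[of ?L x y] \<open>lattice ?L\<close> xc mem closed
    by (auto simp: lattice_def)
  have jc: "j \<in> carrier W" "absolute_le W S x j" "absolute_le W S y j"
    using j xc mem leL closed by (auto simp: least_def Upper_def)
  have j_le: "absolute_le W S j w"
    if "w \<in> carrier W" "absolute_le W S w cox" "absolute_le W S x w" "absolute_le W S y w" for w
    using j that xc mem leL closed by (auto simp: least_def Upper_def)
  have ju: "absolute_le W S j upper" "absolute_le W S j sw.upper" using le by (auto intro: j_le)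
  have eqI: "u = w" if "u \<in> carrier W" "w \<in> carrier W" "absolute_le W S u w" "len u = len w" for u w
  proof -
    have "inv u \<otimes> w = \<one>"
      using that reflection_length_eq_0[OF coxeter, of "inv u \<otimes> w"] by (simp add: absolute_le_def)
    then show ?thesis using that by (metis inv_equality inv_closed inv_inv)
  qed
  have "1 \<le> len j" "len j \<le> 3"
    using jc(2) ju(1) x_le_upper(1) len_upper by (auto simp: absolute_le_def)
  then consider "len j = 1" | "len j = 2" | "len j = 3" by linarith
  then show False
  proof cases
    case 1
    then have "x = j" "y = j" using eqI jc x_le_upper(1) y_le_upper(1) by auto
    then show False using x_neq_y by simp
  next
    case 2
    then show False using no_bound_of_length_2 jc ju by blast
  next
    case 3
    then have "j = upper" "j = sw.upper" using eqI jc ju len_upper sw.len_upper by auto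
    then show False using upper_neq_swapped sw_upper by simp
  qed
qed

end

section \<open>A nondegenerate geometric representation\<close>

text \<open>
  Gluing a symmetric form on a space to the natural pairing of that space with its dual. The second
  summand repairs every degeneracy of \<open>A\<close>, and its basis vectors are dual to those of the first.
\<close>

lemma hyperbolic_form:
  fixes A :: "real^'n^'n"
  assumes A: "transpose A = A"
  shows "symmetric_form (\<lambda>u v. (A *v fst u) \<bullet> fst v + fst u \<bullet> snd v + snd u \<bullet> fst v)"
proof
  fix u v w :: "(real^'n) \<times> (real^'n)" and a :: real
  have "(A *v fst u) \<bullet> fst v = fst u \<bullet> (A *v fst v)"
    using A by (metis dot_lmul_matrix transpose_matrix_vector)
  then show "(A *v fst u) \<bullet> fst v + fst u \<bullet> snd v + snd u \<bullet> fst v =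
      (A *v fst v) \<bullet> fst u + fst v \<bullet> snd u + snd v \<bullet> fst u"
    by (simp add: inner_commute)
  show "(A *v fst (u + v)) \<bullet> fst w + fst (u + v) \<bullet> snd w + snd (u + v) \<bullet> fst w =
      (A *v fst u) \<bullet> fst w + fst u \<bullet> snd w + snd u \<bullet> fst w +
      ((A *v fst v) \<bullet> fst w + fst v \<bullet> snd w + snd v \<bullet> fst w)"
    by (simp add: matrix_vector_right_distrib inner_add_left)
  show "(A *v fst (a *\<^sub>R u)) \<bullet> fst v + fst (a *\<^sub>R u) \<bullet> snd v + snd (a *\<^sub>R u) \<bullet> fst v =
      a * ((A *v fst u) \<bullet> fst v + fst u \<bullet> snd v + snd u \<bullet> fst v)"
    by (simp add: matrix_vector_mult_scaleR distrib_left)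
next
  fix u :: "(real^'n) \<times> (real^'n)"
  assume 0: "\<And>v. (A *v fst v) \<bullet> fst u + fst v \<bullet> snd u + snd v \<bullet> fst u = 0"
  have "fst u = 0" using 0[of "(0, fst u)"] by simp
  moreover from this have "snd u = 0" using 0[of "(snd u, 0)"] by simp
  ultimately show "u = 0" by (simp add: prod_eq_iff)
qed

lemma coxeter_representation_exists:
  fixes m :: "'a \<Rightarrow> 'a \<Rightarrow> nat"
  assumes cs: "coxeter_system W S m" and S: "finite S" "card S = CARD('n::finite)"
  shows "\<exists>(B :: (real^'n) \<times> (real^'n) \<Rightarrow> (real^'n) \<times> (real^'n) \<Rightarrow> real) \<alpha> \<delta>.
    coxeter_representation B W S m \<alpha> \<and>
    (\<forall>s\<in>S. \<forall>t\<in>S. B (\<delta> s) (\<alpha> t) = (if s = t then 1 else 0))"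
proof -
  obtain g :: "'a \<Rightarrow> 'n" where g: "bij_betw g S UNIV"
    using finite_same_card_bij[of S "UNIV :: 'n set"] S by auto
  define e where "e = inv_into S g"
  have eg: "e (g s) = s" if "s \<in> S" for s
    using g that unfolding e_def by (simp add: bij_betw_def)
  have eS: "e i \<in> S" for i
    using g unfolding e_def by (metis bij_betw_def inv_into_into UNIV_I)
  have g_inj: "g s = g t \<longleftrightarrow> s = t" if "s \<in> S" "t \<in> S" for s t
    using eg that by metis
  define A :: "real^'n^'n" where "A = (\<chi> i j. - cos (pi / m (e i) (e j)))"
  have sym: "m s t = m t s" if "s \<in> S" "t \<in> S" for s t
    using cs that by (auto simp: coxeter_system_def coxeter_matrix_def)
  have "transpose A = A"
    using sym eS by (simp add: A_def transpose_def vec_eq_iff)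
  define B where "B = (\<lambda>u v :: (real^'n) \<times> (real^'n).
    (A *v fst u) \<bullet> fst v + fst u \<bullet> snd v + snd u \<bullet> fst v)"
  define \<alpha> where "\<alpha> = (\<lambda>s. (axis (g s) 1, 0) :: (real^'n) \<times> (real^'n))"
  define \<delta> where "\<delta> = (\<lambda>s. (0, axis (g s) 1) :: (real^'n) \<times> (real^'n))"
  interpret symmetric_form B
    unfolding B_def using \<open>transpose A = A\<close> by (rule hyperbolic_form)
  have "coxeter_representation B W S m \<alpha>"
  proof
    fix s t assume st: "s \<in> S" "t \<in> S"
    then show "B (\<alpha> s) (\<alpha> t) = - cos (pi / m s t)"
      using sym by (simp add: B_def \<alpha>_def matrix_vector_mult_basis column_def inner_axis A_def eg)
  qed (rule cs)
  moreover have "B (\<delta> s) (\<alpha> t) = (if s = t then 1 else 0)" if "s \<in> S" "t \<in> S" for s t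
    using g_inj[OF that] by (simp add: B_def \<alpha>_def \<delta>_def inner_axis_axis)
  ultimately show ?thesis by blast
qed

theorem theorem1p5:
  fixes W :: "('a, 'b) monoid_scheme" and S :: "'a set" and m :: "'a \<Rightarrow> 'a \<Rightarrow> nat"
    and s1 s2 s3 s4 c :: 'a and k k' l :: nat
  assumes "k \<ge> 1" and "k' \<ge> 1" and "l \<ge> 3"
    and "coxeter_system W S m"
    and "S = {s1, s2, s3, s4}" and "card S = 4"
    and "m s1 s2 = 2 * k + 1" and "m s2 s3 = l" and "m s3 s4 = 2 * k' + 1" and "m s4 s1 = l"
    and "m s1 s3 = 2" and "m s2 s4 = 2"
    and "c = s3 \<otimes>\<^bsub>W\<^esub> s1 \<otimes>\<^bsub>W\<^esub> s2 \<otimes>\<^bsub>W\<^esub> s4"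
  shows "\<not> lattice (absolute_interval W S c)"
proof -
  have "finite S" "card S = CARD(4)" using assms(5,6) by simp_all
  then obtain B :: "(real^4) \<times> (real^4) \<Rightarrow> (real^4) \<times> (real^4) \<Rightarrow> real" and \<alpha> \<delta>
    where rep: "coxeter_representation B W S m \<alpha>"
      and dual: "\<And>s t. s \<in> S \<Longrightarrow> t \<in> S \<Longrightarrow> B (\<delta> s) (\<alpha> t) = (if s = t then 1 else 0)"
    using coxeter_representation_exists[OF assms(4), where 'n = 4] by blast
  interpret coxeter_representation B W S m \<alpha> by (rule rep)
  have S: "s1 \<in> S" "s2 \<in> S" "s3 \<in> S" "s4 \<in> S" using assms(5) by auto
  obtain x where x: "x \<in> reflections W S" "x \<otimes>\<^bsub>W\<^esub> s1 = s2 \<otimes>\<^bsub>W\<^esub> x" "rep x = refl (\<alpha> s1 + \<alpha> s2)"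
    using S(1,2) assms(7,1) by (rule odd_dihedral_reflection)
  obtain y where y: "y \<in> reflections W S" "y \<otimes>\<^bsub>W\<^esub> s3 = s4 \<otimes>\<^bsub>W\<^esub> y" "rep y = refl (\<alpha> s3 + \<alpha> s4)"
    using S(3,4) assms(9,2) by (rule odd_dihedral_reflection)
  interpret square_coxeter_group B W S m \<alpha> \<delta> s1 s2 s3 s4 k k' l x y
    by unfold_locales (fact assms dual x y)+
  show ?thesis using not_lattice unfolding cox_def \<open>c = _\<close> .
qed

end
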